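(* Consider the nine tensors $T_{N_{1,4}},T_{N_{6,8}},T_{N_{7,9}},T_{N_{10,12}},T_{N_{11,13}},T_{N_{14}},T_{N_{15}},T_{N_{16}},T_{N_{17}}\in\mathbb{C}^5\otimes\mathbb{C}^5\otimes\mathbb{C}^5$ given by the following $5\times5$ matrices of linear forms in the five variables $a,b,c,d,e$: $$T_{N_{1,4}}=\begin{pmatrix}a&0&0&0&0\\ b&a&0&0&0\\ c&0&a&0&0\\ d&0&0&a&0\\ e&0&0&0&a\end{pmatrix},\quad T_{N_{6,8}}=\begin{pmatrix}a&0&0&0&0\\ b&a&0&e&0\\ c&b&a&d&e\\ 0&0&0&a&0\\ e&0&0&0&a\end{pmatrix},\quad T_{N_{7,9}}=\begin{pmatrix}a&0&0&0&0\\ b&a&0&d&0\\ c&b&a&e&d\\ 0&0&0&a&0\\ 0&0&0&b&a\end{pmatrix},$$ $$T_{N_{10,12}}=\begin{pmatrix}a&0&0&0&0\\ b&a&0&0&0\\ c&b&a&0&0\\ d&0&0&a&0\\ e&0&0&0&a\end{pmatrix},\quad T_{N_{11,13}}=\begin{pmatrix}a&0&0&0&0\\ b&a&0&0&0\\ c&b&a&d&0\\ d&0&0&a&0\\ e&0&0&0&a\end{pmatrix},\quad T_{N_{14}}=\begin{pmatrix}a&0&0&0&0\\ b&a&0&0&0\\ c&b&a&d&e\\ d&0&0&a&0\\ e&0&0&0&a\end{pmatrix},$$ $$T_{N_{15}}=\begin{pmatrix}a&0&0&0&0\\ b&a&0&0&0\\ c&b&a&0&0\\ d&c&b&a&0\\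 e&0&0&0&a\end{pmatrix},\quad T_{N_{16}}=\begin{pmatrix}a&0&0&0&0\\ b&a&0&0&0\\ c&b&a&0&0\\ d&c&b&a&e\\ e&0&0&0&a\end{pmatrix},\quad T_{N_{17}}=\begin{pmatrix}a&0&0&0&0\\ b&a&0&0&0\\ c&b&a&0&0\\ d&c&b&a&e\\ 0&0&0&0&a\end{pmatrix}.$$ Then $$\mathbf R(T_{N_{1,4}})=\mathbf R(T_{N_{10,12}})=\mathbf R(T_{N_{11,13}})=\mathbf R(T_{N_{14}})=\mathbf R(T_{N_{15}})=\mathbf R(T_{N_{16}})=\mathbf R(T_{N_{17}})=9$$ and $$\mathbf R(T_{N_{6,8}})=\mathbf R(T_{N_{7,9}})=10.$$
   Context: All vector spaces are over $\mathbb{C}$. A matrix of linear forms $\sum_i y_iM_i$ in independent variables $y_1,\dots,y_5$ (here $a,b,c,d,e$), with $M_i$ constant $5\times5$ matrices, represents the tensor $T=\sum_i a_i\otimes M_i\in\mathbb{C}^5\otimes(\mathbb{C}^5\otimes\mathbb{C}^5)$, where $\{a_i\}$ is a basis of the first factor. $\mathbf R(T)$ is the tensor rank: the least $r$ such that $T$ is a sum of $r$ tensors of the form $u\otimes v\otimes w$. *)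

theory Defs
  imports "HOL-Analysis.Analysis"
begin

text \<open>
  The tensor product \<open>\<complex>\<^sup>l \<otimes> \<complex>\<^sup>m \<otimes> \<complex>\<^sup>n\<close> is identified with the coordinate
  arrays \<open>complex^'n^'m^'l\<close>: the coefficient of \<open>e\<^sub>i \<otimes> e\<^sub>j \<otimes> e\<^sub>k\<close> in \<open>T\<close> is
  \<open>T $ i $ j $ k\<close>.  A matrix in \<open>\<complex>\<^sup>m \<otimes> \<complex>\<^sup>n\<close> is \<open>X :: complex^'n^'m\<close>, rows first.
\<close>

definition tensor_vec_mat :: "complex^'l \<Rightarrow> complex^'n^'m \<Rightarrow> complex^'n^'m^'l" where
  "tensor_vec_mat u X = (\<chi> i j k. u $ i * X $ j $ k)"

definition tensor_vec3 :: "complex^'l \<Rightarrow> complex^'m \<Rightarrow> complex^'n \<Rightarrow> complex^'n^'m^'l" where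
  "tensor_vec3 u v w = (\<chi> i j k. u $ i * v $ j * w $ k)"

definition is_rank_decomp :: "complex^'n^'m^'l \<Rightarrow> nat \<Rightarrow> bool" where
  "is_rank_decomp T r \<longleftrightarrow>
     (\<exists>(u :: nat \<Rightarrow> complex^'l) (v :: nat \<Rightarrow> complex^'m) (w :: nat \<Rightarrow> complex^'n).
        T = (\<Sum>s<r. tensor_vec3 (u s) (v s) (w s)))"

definition tensor_rank :: "complex^'n^'m^'l \<Rightarrow> nat" where
  "tensor_rank T = (LEAST r. is_rank_decomp T r)"

lemma tensor_eq_sum_basis:
  fixes T :: "complex^'n^'m^'l"
  shows "T = (\<Sum>(i, j, k)\<in>UNIV. tensor_vec3 (axis i (T $ i $ j $ k)) (axis j 1) (axis k 1))"
proof -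
  have "(\<Sum>(i, j, k)\<in>UNIV. tensor_vec3 (axis i (T $ i $ j $ k)) (axis j 1) (axis k 1)) $ i' $ j' $ k'
      = T $ i' $ j' $ k'" for i' j' k'
  proof -
    have "(\<Sum>(i, j, k)\<in>UNIV. tensor_vec3 (axis i (T $ i $ j $ k)) (axis j 1) (axis k 1)) $ i' $ j' $ k'
        = (\<Sum>x\<in>UNIV. if x = (i', j', k') then T $ i' $ j' $ k' else 0)"
      unfolding sum_component
      by (rule sum.cong) (auto simp: tensor_vec3_def axis_def split: if_splits)
    then show ?thesis by simp
  qed
  then show ?thesis by (simp add: vec_eq_iff)
qed

text \<open>Every tensor is a finite sum of decomposable ones, so the minimum in \<^const>\<open>tensor_rank\<close> exists.\<close>

lemma is_rank_decomp_exists: "\<exists>r. is_rank_decomp (T :: complex^'n^'m^'l) r"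
proof -
  define U where "U = (UNIV :: ('l \<times> 'm \<times> 'n) set)"
  have "finite U" by (simp add: U_def)
  then obtain h where h: "bij_betw h {..<card U} U"
    using ex_bij_betw_nat_finite lessThan_atLeast0 by metis
  define f where "f = (\<lambda>(i, j, k). tensor_vec3 (axis i (T $ i $ j $ k)) (axis j 1 :: complex^'m) (axis k 1 :: complex^'n))"
  have "T = sum f U"
    using tensor_eq_sum_basis[of T] by (simp add: f_def U_def)
  also have "\<dots> = (\<Sum>s<card U. f (h s))"
    using sum.reindex_bij_betw[OF h, of f] by simp
  finally have "T = (\<Sum>s<card U. f (h s))" .
  then have "is_rank_decomp T (card U)"
    unfolding is_rank_decomp_def f_def case_prod_beta by (intro exI) assumption
  then show ?thesis ..
qed

text \<open>
  A matrix of linear forms in \<open>a, b, c, d, e\<close> is given as a function of the values of the five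
  variables; \<open>M\<^sub>i\<close> is its value at the \<open>i\<close>-th unit vector, and the tensor is
  \<open>\<Sum>\<^sub>i e\<^sub>i \<otimes> M\<^sub>i\<close>.  The index type \<^typ>\<open>5\<close> has the elements \<open>1, 2, 3, 4, 5\<close> (with \<open>5 = 0\<close>),
  and \<^const>\<open>vector\<close> fills the positions \<open>1, \<dots>, 5\<close> in this order.
\<close>

definition tensor_of_forms ::
  "(complex \<Rightarrow> complex \<Rightarrow> complex \<Rightarrow> complex \<Rightarrow> complex \<Rightarrow> complex^5^5) \<Rightarrow> complex^5^5^5" where
  "tensor_of_forms M =
     tensor_vec_mat (axis 1 1) (M 1 0 0 0 0) +
     tensor_vec_mat (axis 2 1) (M 0 1 0 0 0) +
     tensor_vec_mat (axis 3 1) (M 0 0 1 0 0) +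
     tensor_vec_mat (axis 4 1) (M 0 0 0 1 0) +
     tensor_vec_mat (axis 5 1) (M 0 0 0 0 1)"

lemma tensor_of_forms_slice:
  "tensor_of_forms M $ 1 = M 1 0 0 0 0"
  "tensor_of_forms M $ 2 = M 0 1 0 0 0"
  "tensor_of_forms M $ 3 = M 0 0 1 0 0"
  "tensor_of_forms M $ 4 = M 0 0 0 1 0"
  "tensor_of_forms M $ 5 = M 0 0 0 0 1"
  by (simp_all add: tensor_of_forms_def tensor_vec_mat_def axis_def vec_eq_iff)

definition mat5 :: "complex list list \<Rightarrow> complex^5^5" where
  "mat5 L = vector (map vector L)"

lemma vector_5:
  "(vector [v, w, x, y, z] :: ('a::zero)^5) $ 1 = v"
  "(vector [v, w, x, y, z] :: ('a::zero)^5) $ 2 = w"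
  "(vector [v, w, x, y, z] :: ('a::zero)^5) $ 3 = x"
  "(vector [v, w, x, y, z] :: ('a::zero)^5) $ 4 = y"
  "(vector [v, w, x, y, z] :: ('a::zero)^5) $ 5 = z"
  by (simp_all add: vector_def)

definition T_N1_4 :: "complex^5^5^5" where
  "T_N1_4 = tensor_of_forms (\<lambda>a b c d e. mat5
    [[a, 0, 0, 0, 0],
     [b, a, 0, 0, 0],
     [c, 0, a, 0, 0],
     [d, 0, 0, a, 0],
     [e, 0, 0, 0, a]])"

definition T_N6_8 :: "complex^5^5^5" where
  "T_N6_8 = tensor_of_forms (\<lambda>a b c d e. mat5
    [[a, 0, 0, 0, 0],
     [b, a, 0, e, 0],
     [c, b, a, d, e],
     [0, 0, 0, a, 0],
     [e, 0, 0, 0, a]])"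

definition T_N7_9 :: "complex^5^5^5" where
  "T_N7_9 = tensor_of_forms (\<lambda>a b c d e. mat5
    [[a, 0, 0, 0, 0],
     [b, a, 0, d, 0],
     [c, b, a, e, d],
     [0, 0, 0, a, 0],
     [0, 0, 0, b, a]])"

definition T_N10_12 :: "complex^5^5^5" where
  "T_N10_12 = tensor_of_forms (\<lambda>a b c d e. mat5
    [[a, 0, 0, 0, 0],
     [b, a, 0, 0, 0],
     [c, b, a, 0, 0],
     [d, 0, 0, a, 0],
     [e, 0, 0, 0, a]])"

definition T_N11_13 :: "complex^5^5^5" where
  "T_N11_13 = tensor_of_forms (\<lambda>a b c d e. mat5
    [[a, 0, 0, 0, 0],
     [b, a, 0, 0, 0],
     [c, b, a, d, 0],
     [d, 0, 0, a, 0],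
     [e, 0, 0, 0, a]])"

definition T_N14 :: "complex^5^5^5" where
  "T_N14 = tensor_of_forms (\<lambda>a b c d e. mat5
    [[a, 0, 0, 0, 0],
     [b, a, 0, 0, 0],
     [c, b, a, d, e],
     [d, 0, 0, a, 0],
     [e, 0, 0, 0, a]])"

definition T_N15 :: "complex^5^5^5" where
  "T_N15 = tensor_of_forms (\<lambda>a b c d e. mat5
    [[a, 0, 0, 0, 0],
     [b, a, 0, 0, 0],
     [c, b, a, 0, 0],
     [d, c, b, a, 0],
     [e, 0, 0, 0, a]])"

definition T_N16 :: "complex^5^5^5" where
  "T_N16 = tensor_of_forms (\<lambda>a b c d e. mat5
    [[a, 0, 0, 0, 0],
     [b, a, 0, 0, 0],
     [c, b, a, 0, 0],
     [d, c, b, a, e],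
     [e, 0, 0, 0, a]])"

definition T_N17 :: "complex^5^5^5" where
  "T_N17 = tensor_of_forms (\<lambda>a b c d e. mat5
    [[a, 0, 0, 0, 0],
     [b, a, 0, 0, 0],
     [c, b, a, 0, 0],
     [d, c, b, a, e],
     [0, 0, 0, 0, a]])"

end

theory Submission
  imports Defs
begin

text \<open>
  Lower bounds come from the substitution method: if the tensor, seen as a trilinear form, is
  injective on a coordinate subspace of dimension \<open>m\<close> of one factor, then \<open>m\<close> of the products in a
  decomposition can be killed by moving every vector along that subspace.  For all nine tensors,
  killing four products along \<open>a = 0\<close> leaves an invertible \<open>5 \<times> 5\<close> matrix, so the rank is at least
  \<open>4 + 5\<close>.  \<open>T_N6_8\<close> and \<open>T_N7_9\<close> are, up to permutations in the last two factors, the structure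
  tensors of local algebras whose radical has a two-dimensional square.  There one kills two products
  in each argument along the squared radical and then four in the output; a decomposition of
  length 9 would leave at most one product, but a \<open>2 \<times> 2\<close> minor on generators of the radical does
  not vanish.
\<close>

section \<open>Tensors as trilinear forms\<close>

text \<open>A complex bilinear pairing without conjugation, so that a decomposable tensor evaluates
  to a product of three linear forms.\<close>

definition lform :: "complex^'n \<Rightarrow> complex^'n \<Rightarrow> complex" where
  "lform u x = (\<Sum>i\<in>UNIV. u $ i * x $ i)"

definition tform :: "complex^'n^'m^'l \<Rightarrow> complex^'l \<Rightarrow> complex^'m \<Rightarrow> complex^'n \<Rightarrow> complex" where
  "tform T x y z = (\<Sum>i\<in>UNIV. \<Sum>j\<in>UNIV. \<Sum>k\<in>UNIV. T $ i $ j $ k * x $ i * y $ j * z $ k)"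

lemma lform_add_scaled: "lform u (x + c *s y) = lform u x + c * lform u y"
  by (simp add: lform_def algebra_simps sum.distrib sum_distrib_left)

lemma tform_sum: "tform (\<Sum>s\<in>S. F s) x y z = (\<Sum>s\<in>S. tform (F s) x y z)"
  by (induction S rule: infinite_finite_induct)
     (simp_all add: tform_def distrib_right sum.distrib)

lemma tform_vec3: "tform (tensor_vec3 u v w) x y z = lform u x * lform v y * lform w z"
proof -
  have "tform (tensor_vec3 u v w) x y z
      = (\<Sum>i\<in>UNIV. \<Sum>j\<in>UNIV. \<Sum>k\<in>UNIV. (u $ i * x $ i) * (v $ j * y $ j) * (w $ k * z $ k))"
    by (simp add: tform_def tensor_vec3_def mult_ac)
  then show ?thesis
    by (simp only: lform_def sum_distrib_left[symmetric] sum_distrib_right[symmetric])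
qed

lemma tform_decomp:
  assumes "T = (\<Sum>s<r. tensor_vec3 (u s) (v s) (w s))"
  shows "tform T x y z = (\<Sum>s<r. lform (u s) x * lform (v s) y * lform (w s) z)"
  by (simp add: assms tform_sum tform_vec3)

section \<open>The substitution method and two rank bounds\<close>

text \<open>Forms with no common zero on the coordinate subspace of \<open>I\<close> contain a basis
  of its dual; the equations they impose can then be solved for the coordinates in \<open>I\<close>,
  whatever the other coordinates are. The basis is built by adding one form for each
  coordinate.\<close>

lemma substitution:
  fixes u :: "'s \<Rightarrow> complex^'n"
  assumes "finite I"
    and "\<And>x. (\<forall>i. i \<notin> I \<longrightarrow> x $ i = 0) \<Longrightarrow> (\<forall>s\<in>S. lform (u s) x = 0) \<Longrightarrow> x = 0"
  shows "\<exists>S'\<subseteq>S. finite S' \<and> card S' = card I \<and>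
    (\<forall>x. \<exists>x'. (\<forall>i. i \<notin> I \<longrightarrow> x' $ i = x $ i) \<and> (\<forall>s\<in>S'. lform (u s) x' = 0))"
  using assms
proof (induction I rule: finite_induct)
  case empty
  show ?case by (rule exI[of _ "{}"]) auto
next
  case (insert i J)
  have "\<exists>S'\<subseteq>S. finite S' \<and> card S' = card J \<and>
    (\<forall>x. \<exists>x'. (\<forall>i. i \<notin> J \<longrightarrow> x' $ i = x $ i) \<and> (\<forall>s\<in>S'. lform (u s) x' = 0))"
    by (rule insert.IH) (use insert.prems in auto)
  then obtain S' where S': "S' \<subseteq> S" "finite S'" "card S' = card J"
    and lift: "\<And>x. \<exists>x'. (\<forall>i. i \<notin> J \<longrightarrow> x' $ i = x $ i) \<and> (\<forall>s\<in>S'. lform (u s) x' = 0)"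
    by blast
  \<comment> \<open>Lifting the unit vector at \<open>i\<close> gives a nonzero vector supported on
    \<open>insert i J\<close> that the forms chosen so far kill; hence some form of \<open>S\<close>
    detects it.\<close>
  obtain x0 where x0: "\<And>k. k \<notin> J \<Longrightarrow> x0 $ k = axis i 1 $ k" "\<And>s. s \<in> S' \<Longrightarrow> lform (u s) x0 = 0"
    using lift by blast
  have "x0 $ i = 1" using x0(1)[OF \<open>i \<notin> J\<close>] by (simp add: axis_def)
  then have "x0 \<noteq> 0" by auto
  moreover have "\<forall>k. k \<notin> insert i J \<longrightarrow> x0 $ k = 0" using x0(1) by (simp add: axis_def)
  ultimately obtain s0 where s0: "s0 \<in> S" "lform (u s0) x0 \<noteq> 0"
    using insert.prems by blast
  have "s0 \<notin> S'" using s0 x0(2) by blast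
  have "\<exists>x''. (\<forall>k. k \<notin> insert i J \<longrightarrow> x'' $ k = x $ k) \<and> (\<forall>s\<in>insert s0 S'. lform (u s) x'' = 0)" for x
  proof -
    obtain x' where x': "\<And>k. k \<notin> J \<Longrightarrow> x' $ k = x $ k" "\<And>s. s \<in> S' \<Longrightarrow> lform (u s) x' = 0"
      using lift by blast
    \<comment> \<open>The multiple of \<open>x0\<close> is chosen to cancel the new form; the old
      forms vanish on \<open>x0\<close> and are not disturbed.\<close>
    define x'' where "x'' = x' + (- lform (u s0) x' / lform (u s0) x0) *s x0"
    have "x'' $ k = x $ k" if "k \<notin> insert i J" for k
      using that x'(1)[of k] x0(1)[of k] by (auto simp: x''_def axis_def)
    moreover have "lform (u s) x'' = 0" if "s \<in> insert s0 S'" for s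
      using that x'(2)[of s] x0(2)[of s] s0(2) unfolding x''_def lform_add_scaled by auto
    ultimately show ?thesis by blast
  qed
  then show ?case
    using S' s0 \<open>s0 \<notin> S'\<close> insert.hyps by (intro exI[of _ "insert s0 S'"]) simp
qed

text \<open>
  In the next two lemmas, a vector agreeing with a given one off \<open>I\<close> is one produced from it by
  \<open>substitution\<close>; the hypotheses must hold for all of them, since the correction on \<open>I\<close> is unknown.
\<close>

lemma rank_lower_bound_regular:
  fixes T :: "complex^'n^'m^'l"
  assumes dec: "is_rank_decomp T r"
    and x_inj: "\<And>x. (\<forall>i. i \<notin> I \<longrightarrow> x $ i = 0) \<Longrightarrow> (\<forall>y z. tform T x y z = 0) \<Longrightarrow> x = 0"
    and y_inj: "\<And>x y. (\<forall>i. i \<notin> I \<longrightarrow> x $ i = x0 $ i) \<Longrightarrow> (\<forall>z. tform T x y z = 0) \<Longrightarrow> y = 0"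
  shows "card I + CARD('m) \<le> r"
proof -
  obtain u v w where T: "T = (\<Sum>s<r. tensor_vec3 (u s) (v s) (w s))"
    using dec unfolding is_rank_decomp_def by blast
  note tf = tform_decomp[OF T]
  \<comment> \<open>A common zero of all the forms \<open>u s\<close> makes every product vanish, so
    \<open>x_inj\<close> gives the hypothesis of \<open>substitution\<close>.\<close>
  obtain S1 where S1: "S1 \<subseteq> {..<r}" "card S1 = card I"
    and lift: "\<And>x. \<exists>x'. (\<forall>i. i \<notin> I \<longrightarrow> x' $ i = x $ i) \<and> (\<forall>s\<in>S1. lform (u s) x' = 0)"
    using substitution[of I "{..<r}" u] x_inj by (auto simp: tf)
  obtain x where x: "\<forall>i. i \<notin> I \<longrightarrow> x $ i = x0 $ i" "\<forall>s\<in>S1. lform (u s) x = 0"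
    using lift by blast
  have tf1: "tform T x y z = (\<Sum>s\<in>{..<r}-S1. lform (u s) x * lform (v s) y * lform (w s) z)" for y z
    unfolding tf using x by (intro sum.mono_neutral_right) auto
  \<comment> \<open>At the fixed \<open>x\<close> only the products outside \<open>S1\<close>
    survive, and they must still separate the whole second factor.\<close>
  obtain S2 where S2: "S2 \<subseteq> {..<r}-S1" "card S2 = CARD('m)"
    using substitution[of UNIV "{..<r}-S1" v] y_inj[OF x(1)] by (auto simp: tf1)
  have fin: "finite S1" "finite S2" using S1 S2 by (auto intro: finite_subset)
  have "card (S1 \<union> S2) = card I + CARD('m)"
    using S1 S2 fin by (subst card_Un_disjoint) auto
  moreover have "card (S1 \<union> S2) \<le> card {..<r}"
    using S1 S2 by (intro card_mono) auto
  ultimately show ?thesis by simp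
qed

lemma rank_lower_bound_minor:
  fixes T :: "complex^'n^'m^'l"
  assumes dec: "is_rank_decomp T r"
    and x_inj: "\<And>x. (\<forall>i. i \<notin> I \<longrightarrow> x $ i = 0) \<Longrightarrow> (\<forall>y z. tform T x y z = 0) \<Longrightarrow> x = 0"
    and y_inj: "\<And>x y. (\<forall>i. i \<notin> I \<longrightarrow> x $ i = axis p0 1 $ i) \<Longrightarrow> (\<forall>j. j \<notin> J \<longrightarrow> y $ j = 0) \<Longrightarrow>
      (\<forall>z. tform T x y z = 0) \<Longrightarrow> y = 0"
    and z_inj: "\<And>X Y z. (\<forall>p i. i \<notin> I \<longrightarrow> X p $ i = axis p 1 $ i) \<Longrightarrow>
      (\<forall>q j. j \<notin> J \<longrightarrow> Y q $ j = axis q 1 $ j) \<Longrightarrow> (\<forall>k. k \<notin> K \<longrightarrow> z $ k = 0) \<Longrightarrow>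
      (\<forall>p q. tform T (X p) (Y q) z = 0) \<Longrightarrow> z = 0"
    and minor: "\<And>X Y z. (\<forall>p i. i \<notin> I \<longrightarrow> X p $ i = axis p 1 $ i) \<Longrightarrow>
      (\<forall>q j. j \<notin> J \<longrightarrow> Y q $ j = axis q 1 $ j) \<Longrightarrow> (\<forall>k. k \<notin> K \<longrightarrow> z $ k = axis k0 1 $ k) \<Longrightarrow>
      tform T (X p1) (Y q1) z * tform T (X p2) (Y q2) z
        \<noteq> tform T (X p1) (Y q2) z * tform T (X p2) (Y q1) z"
  shows "card I + card J + card K + 2 \<le> r"
proof (rule ccontr)
  assume small: "\<not> card I + card J + card K + 2 \<le> r"
  obtain u v w where T: "T = (\<Sum>s<r. tensor_vec3 (u s) (v s) (w s))"
    using dec unfolding is_rank_decomp_def by blast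
  note tf = tform_decomp[OF T]
  obtain S1 where S1: "S1 \<subseteq> {..<r}" "card S1 = card I"
    and lift1: "\<And>x. \<exists>x'. (\<forall>i. i \<notin> I \<longrightarrow> x' $ i = x $ i) \<and> (\<forall>s\<in>S1. lform (u s) x' = 0)"
    using substitution[of I "{..<r}" u] x_inj by (auto simp: tf)
  \<comment> \<open>All unit vectors are corrected against the same set \<open>S1\<close>, so these
    products disappear for every \<open>p\<close> at once.\<close>
  obtain X where X: "\<forall>p i. i \<notin> I \<longrightarrow> X p $ i = axis p 1 $ i" "\<And>p s. s \<in> S1 \<Longrightarrow> lform (u s) (X p) = 0"
    using lift1[of "axis _ 1"] by metis
  have tf1: "tform T (X p) y z = (\<Sum>s\<in>{..<r}-S1. lform (u s) (X p) * lform (v s) y * lform (w s) z)" for p y z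
    unfolding tf using X by (intro sum.mono_neutral_right) auto
  \<comment> \<open>A single vector \<open>X p0\<close> suffices; in the applications
    \<open>p0\<close> is the index of the unit of the algebra.\<close>
  have "y = 0" if "\<forall>j. j \<notin> J \<longrightarrow> y $ j = 0" "\<forall>s\<in>{..<r}-S1. lform (v s) y = 0" for y
    using y_inj[of "X p0" y] that X(1) by (simp add: tf1)
  then obtain S2 where S2: "S2 \<subseteq> {..<r}-S1" "card S2 = card J"
    and lift2: "\<And>y. \<exists>y'. (\<forall>j. j \<notin> J \<longrightarrow> y' $ j = y $ j) \<and> (\<forall>s\<in>S2. lform (v s) y' = 0)"
    using substitution[of J "{..<r}-S1" v] by auto
  obtain Y where Y: "\<forall>q j. j \<notin> J \<longrightarrow> Y q $ j = axis q 1 $ j" "\<And>q s. s \<in> S2 \<Longrightarrow> lform (v s) (Y q) = 0"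
    using lift2[of "axis _ 1"] by metis
  have tf2: "tform T (X p) (Y q) z
      = (\<Sum>s\<in>{..<r}-S1-S2. lform (u s) (X p) * lform (v s) (Y q) * lform (w s) z)" for p q z
    unfolding tf1 using Y by (intro sum.mono_neutral_right) auto
  have "z = 0" if "\<forall>k. k \<notin> K \<longrightarrow> z $ k = 0" "\<forall>s\<in>{..<r}-S1-S2. lform (w s) z = 0" for z
    using z_inj[OF X(1) Y(1) that(1)] that by (simp add: tf2)
  then obtain S3 where S3: "S3 \<subseteq> {..<r}-S1-S2" "card S3 = card K"
    and lift3: "\<And>z. \<exists>z'. (\<forall>k. k \<notin> K \<longrightarrow> z' $ k = z $ k) \<and> (\<forall>s\<in>S3. lform (w s) z' = 0)"
    using substitution[of K "{..<r}-S1-S2" w] by auto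
  obtain z where z: "\<forall>k. k \<notin> K \<longrightarrow> z $ k = axis k0 1 $ k" "\<And>s. s \<in> S3 \<Longrightarrow> lform (w s) z = 0"
    using lift3[of "axis k0 1"] by metis
  define R where "R = {..<r}-S1-S2-S3"
  have tf3: "tform T (X p) (Y q) z
      = (\<Sum>s\<in>R. lform (u s) (X p) * lform (v s) (Y q) * lform (w s) z)" for p q
    unfolding tf2 R_def using z by (intro sum.mono_neutral_right) auto
  have fin: "finite S1" "finite S2" "finite S3"
    using S1(1) S2(1) S3(1) by (auto intro: finite_subset)
  \<comment> \<open>\<open>S1\<close>, \<open>S2\<close>, \<open>S3\<close> are disjoint by
    construction, so each removes its full number of products, and the negated bound leaves at most
    one.\<close>
  have "card R = r - card I - card J - card K"
    using S1 S2 S3 fin by (simp add: R_def card_Diff_subset)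
  with small have "card R \<le> 1" by linarith
  moreover have "finite R" by (simp add: R_def)
  ultimately consider "R = {}" | s where "R = {s}"
    by (metis One_nat_def card_0_eq card_1_singletonE le_SucE le_zero_eq)
  \<comment> \<open>With at most one product left, the matrix of values indexed by \<open>p\<close>
    and \<open>q\<close> has rank at most one, so its minors vanish.\<close>
  then have "tform T (X p1) (Y q1) z * tform T (X p2) (Y q2) z
        = tform T (X p1) (Y q2) z * tform T (X p2) (Y q1) z"
    by cases (simp_all add: tf3)
  with minor[OF X(1) Y(1) z(1)] show False by blast
qed

section \<open>Explicit decompositions and coordinates of the nine forms\<close>

lemma is_rank_decomp_list:
  assumes "T = (\<Sum>(u, v, w)\<leftarrow>L. tensor_vec3 u v w)" "length L = r"
  shows "is_rank_decomp T r"
proof -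
  have "T = (\<Sum>s<length L. tensor_vec3 (fst (L ! s)) (fst (snd (L ! s))) (snd (snd (L ! s))))"
    unfolding assms(1) by (simp add: sum_list_sum_nth case_prod_beta lessThan_atLeast0)
  then show ?thesis unfolding is_rank_decomp_def assms(2) by (intro exI) assumption
qed

lemma tensor_rank_eqI:
  assumes "is_rank_decomp T r" "\<And>s. is_rank_decomp T s \<Longrightarrow> r \<le> s"
  shows "tensor_rank T = r"
  unfolding tensor_rank_def using assms by (rule Least_equality)

lemma exhaust_5: "i = 1 \<or> i = 2 \<or> i = 3 \<or> i = 4 \<or> i = (5::5)"
proof (induct i)
  case (of_int z)
  \<comment> \<open>The representatives run from 0 to 4, and the residue 0 is the element 5.\<close>
  then have "z = 0 \<or> z = 1 \<or> z = 2 \<or> z = 3 \<or> z = 4" by auto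
  then show ?case by auto
qed

lemma forall_5: "(\<forall>i::5. P i) \<longleftrightarrow> P 1 \<and> P 2 \<and> P 3 \<and> P 4 \<and> P 5"
  by (metis exhaust_5)

lemma UNIV_5: "UNIV = {1, 2, 3, 4, 5::5}"
  using exhaust_5 by auto

lemma sum_5: "(\<Sum>i\<in>UNIV. f i) = f 1 + f 2 + f 3 + f 4 + f (5::5)"
  unfolding UNIV_5 by (simp add: add.assoc)

lemmas expand_simps = vec_eq_iff forall_5 sum_5 tensor_of_forms_slice mat5_def vector_5

text \<open>For \<open>M(x)\<close> the matrix of linear forms at \<open>x\<close>, the trilinear
  form is \<open>y^T M(x) z\<close>; the coefficient of \<open>z$k\<close> is read off column
  \<open>k\<close>. The same holds for the eight forms below.\<close>

lemma tform_N1_4: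
  "tform T_N1_4 x y z =
    (x$1 * y$1 + x$2 * y$2 + x$3 * y$3 + x$4 * y$4 + x$5 * y$5) * z$1 + (x$1 * y$2) * z$2 + (x$1 * y$3) * z$3
    + (x$1 * y$4) * z$4 + (x$1 * y$5) * z$5"
  by (simp add: T_N1_4_def tform_def sum_5 tensor_of_forms_slice mat5_def vector_5 algebra_simps)

lemma tform_N10_12:
  "tform T_N10_12 x y z =
    (x$1 * y$1 + x$2 * y$2 + x$3 * y$3 + x$4 * y$4 + x$5 * y$5) * z$1 + (x$1 * y$2 + x$2 * y$3) * z$2 + (x$1 * y$3) * z$3
    + (x$1 * y$4) * z$4 + (x$1 * y$5) * z$5"
  by (simp add: T_N10_12_def tform_def sum_5 tensor_of_forms_slice mat5_def vector_5 algebra_simps)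

lemma tform_N11_13:
  "tform T_N11_13 x y z =
    (x$1 * y$1 + x$2 * y$2 + x$3 * y$3 + x$4 * y$4 + x$5 * y$5) * z$1 + (x$1 * y$2 + x$2 * y$3) * z$2 + (x$1 * y$3) * z$3
    + (x$4 * y$3 + x$1 * y$4) * z$4 + (x$1 * y$5) * z$5"
  by (simp add: T_N11_13_def tform_def sum_5 tensor_of_forms_slice mat5_def vector_5 algebra_simps)

lemma tform_N14:
  "tform T_N14 x y z =
    (x$1 * y$1 + x$2 * y$2 + x$3 * y$3 + x$4 * y$4 + x$5 * y$5) * z$1 + (x$1 * y$2 + x$2 * y$3) * z$2 + (x$1 * y$3) * z$3
    + (x$4 * y$3 + x$1 * y$4) * z$4 + (x$5 * y$3 + x$1 * y$5) * z$5"
  by (simp add: T_N14_def tform_def sum_5 tensor_of_forms_slice mat5_def vector_5 algebra_simps)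

lemma tform_N15:
  "tform T_N15 x y z =
    (x$1 * y$1 + x$2 * y$2 + x$3 * y$3 + x$4 * y$4 + x$5 * y$5) * z$1 + (x$1 * y$2 + x$2 * y$3 + x$3 * y$4) * z$2 + (x$1 * y$3 + x$2 * y$4) * z$3
    + (x$1 * y$4) * z$4 + (x$1 * y$5) * z$5"
  by (simp add: T_N15_def tform_def sum_5 tensor_of_forms_slice mat5_def vector_5 algebra_simps)

lemma tform_N16:
  "tform T_N16 x y z =
    (x$1 * y$1 + x$2 * y$2 + x$3 * y$3 + x$4 * y$4 + x$5 * y$5) * z$1 + (x$1 * y$2 + x$2 * y$3 + x$3 * y$4) * z$2 + (x$1 * y$3 + x$2 * y$4) * z$3
    + (x$1 * y$4) * z$4 + (x$5 * y$4 + x$1 * y$5) * z$5"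
  by (simp add: T_N16_def tform_def sum_5 tensor_of_forms_slice mat5_def vector_5 algebra_simps)

lemma tform_N17:
  "tform T_N17 x y z =
    (x$1 * y$1 + x$2 * y$2 + x$3 * y$3 + x$4 * y$4) * z$1 + (x$1 * y$2 + x$2 * y$3 + x$3 * y$4) * z$2 + (x$1 * y$3 + x$2 * y$4) * z$3
    + (x$1 * y$4) * z$4 + (x$5 * y$4 + x$1 * y$5) * z$5"
  by (simp add: T_N17_def tform_def sum_5 tensor_of_forms_slice mat5_def vector_5 algebra_simps)

lemma tform_N6_8:
  "tform T_N6_8 x y z =
    (x$1 * y$1 + x$2 * y$2 + x$3 * y$3 + x$5 * y$5) * z$1 + (x$1 * y$2 + x$2 * y$3) * z$2 + (x$1 * y$3) * z$3
    + (x$5 * y$2 + x$4 * y$3 + x$1 * y$4) * z$4 + (x$5 * y$3 + x$1 * y$5) * z$5"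
  by (simp add: T_N6_8_def tform_def sum_5 tensor_of_forms_slice mat5_def vector_5 algebra_simps)

lemma tform_N7_9:
  "tform T_N7_9 x y z =
    (x$1 * y$1 + x$2 * y$2 + x$3 * y$3) * z$1 + (x$1 * y$2 + x$2 * y$3) * z$2 + (x$1 * y$3) * z$3
    + (x$4 * y$2 + x$5 * y$3 + x$1 * y$4 + x$2 * y$5) * z$4 + (x$4 * y$3 + x$1 * y$5) * z$5"
  by (simp add: T_N7_9_def tform_def sum_5 tensor_of_forms_slice mat5_def vector_5 algebra_simps)

section \<open>Upper bounds\<close>

text \<open>The form has only nine monomials: five from the diagonal, four from the rest of the
  first column.\<close>

lemma N1_4_upper: "is_rank_decomp T_N1_4 9"
proof -
  have "T_N1_4 = (\<Sum>(u, v, w)\<leftarrow>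
    [(vector [1, 0, 0, 0, 0], vector [1, 0, 0, 0, 0], vector [1, 0, 0, 0, 0]),
     (vector [1, 0, 0, 0, 0], vector [0, 1, 0, 0, 0], vector [0, 1, 0, 0, 0]),
     (vector [0, 1, 0, 0, 0], vector [0, 1, 0, 0, 0], vector [1, 0, 0, 0, 0]),
     (vector [1, 0, 0, 0, 0], vector [0, 0, 1, 0, 0], vector [0, 0, 1, 0, 0]),
     (vector [0, 0, 1, 0, 0], vector [0, 0, 1, 0, 0], vector [1, 0, 0, 0, 0]),
     (vector [1, 0, 0, 0, 0], vector [0, 0, 0, 1, 0], vector [0, 0, 0, 1, 0]),
     (vector [0, 0, 0, 1, 0], vector [0, 0, 0, 1, 0], vector [1, 0, 0, 0, 0]),
     (vector [1, 0, 0, 0, 0], vector [0, 0, 0, 0, 1], vector [0, 0, 0, 0, 1]),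
     (vector [0, 0, 0, 0, 1], vector [0, 0, 0, 0, 1], vector [1, 0, 0, 0, 0])]. tensor_vec3 u v w)"
    by (simp add: T_N1_4_def expand_simps tensor_vec3_def)
  then show ?thesis by (rule is_rank_decomp_list) simp
qed

text \<open>
  The pair \<open>(x\<^sub>i + x\<^sub>1)(y\<^sub>i + y\<^sub>1)\<close>, \<open>(x\<^sub>i - x\<^sub>1)(y\<^sub>i - y\<^sub>1)\<close> of products yields \<open>x\<^sub>i y\<^sub>1 + x\<^sub>1 y\<^sub>i\<close>, and
  also \<open>x\<^sub>i y\<^sub>i\<close> up to the product \<open>x\<^sub>1 y\<^sub>1\<close>, which is needed anyway.
\<close>

lemma N10_12_upper: "is_rank_decomp T_N10_12 9"
proof -
  have "T_N10_12 = (\<Sum>(u, v, w)\<leftarrow>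
    [(vector [1, 0, 0, 0, 0], vector [1, 0, -1, 0, 0], vector [1, 0, 0, 0, 0]),
     (vector [1, 1, 0, 0, 0], vector [0, 1/2, 1/2, 0, 0], vector [1, 1, 0, 0, 0]),
     (vector [-1, 1, 0, 0, 0], vector [0, -1/2, 1/2, 0, 0], vector [-1, 1, 0, 0, 0]),
     (vector [1, 0, 0, 0, 0], vector [0, 0, 1, 0, 0], vector [0, 0, 1, 0, 0]),
     (vector [0, 0, 1, 0, 0], vector [0, 0, 1, 0, 0], vector [1, 0, 0, 0, 0]),
     (vector [1, 0, 0, 0, 0], vector [0, 0, 0, 1, 0], vector [0, 0, 0, 1, 0]),
     (vector [0, 0, 0, 1, 0], vector [0, 0, 0, 1, 0], vector [1, 0, 0, 0, 0]),
     (vector [1, 0, 0, 0, 0], vector [0, 0, 0, 0, 1], vector [0, 0, 0, 0, 1]),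
     (vector [0, 0, 0, 0, 1], vector [0, 0, 0, 0, 1], vector [1, 0, 0, 0, 0])]. tensor_vec3 u v w)"
    by (simp add: T_N10_12_def expand_simps tensor_vec3_def)
  then show ?thesis by (rule is_rank_decomp_list) simp
qed

text \<open>Two pairs, for the indices 2 and 4, with \<open>y$3\<close> in the role of
  \<open>y_1\<close>. Each leaves a surplus \<open>x$1 * y$3\<close> at \<open>z$1\<close>, and the
  entry -2 of the first product removes both.\<close>

lemma N11_13_upper: "is_rank_decomp T_N11_13 9"
proof -
  have "T_N11_13 = (\<Sum>(u, v, w)\<leftarrow>
    [(vector [1, 0, 0, 0, 0], vector [1, 0, -2, 0, 0], vector [1, 0, 0, 0, 0]),
     (vector [1, 1, 0, 0, 0], vector [0, 1/2, 1/2, 0, 0], vector [1, 1, 0, 0, 0]),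
     (vector [-1, 1, 0, 0, 0], vector [0, -1/2, 1/2, 0, 0], vector [-1, 1, 0, 0, 0]),
     (vector [1, 0, 0, 1, 0], vector [0, 0, 1/2, 1/2, 0], vector [1, 0, 0, 1, 0]),
     (vector [-1, 0, 0, 1, 0], vector [0, 0, 1/2, -1/2, 0], vector [-1, 0, 0, 1, 0]),
     (vector [1, 0, 0, 0, 0], vector [0, 0, 1, 0, 0], vector [0, 0, 1, 0, 0]),
     (vector [0, 0, 1, 0, 0], vector [0, 0, 1, 0, 0], vector [1, 0, 0, 0, 0]),
     (vector [1, 0, 0, 0, 0], vector [0, 0, 0, 0, 1], vector [0, 0, 0, 0, 1]),
     (vector [0, 0, 0, 0, 1], vector [0, 0, 0, 0, 1], vector [1, 0, 0, 0, 0])]. tensor_vec3 u v w)"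
    by (simp add: T_N11_13_def expand_simps tensor_vec3_def)
  then show ?thesis by (rule is_rank_decomp_list) simp
qed

text \<open>A third pair, for the index 5, replaces two single monomials and raises the surplus to
  3.\<close>

lemma N14_upper: "is_rank_decomp T_N14 9"
proof -
  have "T_N14 = (\<Sum>(u, v, w)\<leftarrow>
    [(vector [1, 0, 0, 0, 0], vector [1, 0, -3, 0, 0], vector [1, 0, 0, 0, 0]),
     (vector [1, 1, 0, 0, 0], vector [0, 1/2, 1/2, 0, 0], vector [1, 1, 0, 0, 0]),
     (vector [-1, 1, 0, 0, 0], vector [0, -1/2, 1/2, 0, 0], vector [-1, 1, 0, 0, 0]),
     (vector [1, 0, 0, 1, 0], vector [0, 0, 1/2, 1/2, 0], vector [1, 0, 0, 1, 0]),
     (vector [-1, 0, 0, 1, 0], vector [0, 0, 1/2, -1/2, 0], vector [-1, 0, 0, 1, 0]),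
     (vector [1, 0, 0, 0, 1], vector [0, 0, 1/2, 0, 1/2], vector [1, 0, 0, 0, 1]),
     (vector [-1, 0, 0, 0, 1], vector [0, 0, 1/2, 0, -1/2], vector [-1, 0, 0, 0, 1]),
     (vector [1, 0, 0, 0, 0], vector [0, 0, 1, 0, 0], vector [0, 0, 1, 0, 0]),
     (vector [0, 0, 1, 0, 0], vector [0, 0, 1, 0, 0], vector [1, 0, 0, 0, 0])]. tensor_vec3 u v w)"
    by (simp add: T_N14_def expand_simps tensor_vec3_def)
  then show ?thesis by (rule is_rank_decomp_list) simp
qed

text \<open>
  The first five products multiply \<open>a + b t + c t\<^sup>2\<close> with its counterpart by interpolation at
  \<open>t = 1, -1, 2, 0, \<infinity>\<close>.
\<close>

lemma N15_upper: "is_rank_decomp T_N15 9"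
proof -
  have "T_N15 = (\<Sum>(u, v, w)\<leftarrow>
    [(vector [1, 1, 1, 0, 0], vector [0, 1, 1/2, -1/2, 0], vector [1, 1, 1, 0, 0]),
     (vector [1, -1, 1, 0, 0], vector [0, -1/3, 1/2, -1/6, 0], vector [1, -1, 1, 0, 0]),
     (vector [1, 2, 4, 0, 0], vector [0, -1/6, 0, 1/6, 0], vector [1, 2, 4, 0, 0]),
     (vector [1, 0, 0, 0, 0], vector [1, -1/2, -1, 1/2, 0], vector [1, 0, 0, 0, 0]),
     (vector [0, 0, 1, 0, 0], vector [0, 2, -1, -2, 0], vector [0, 0, 1, 0, 0]),
     (vector [1, 0, 0, 0, 0], vector [0, 0, 0, 1, 0], vector [0, 0, 0, 1, 0]),
     (vector [0, 0, 0, 1, 0], vector [0, 0, 0, 1, 0], vector [1, 0, 0, 0, 0]),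
     (vector [1, 0, 0, 0, 0], vector [0, 0, 0, 0, 1], vector [0, 0, 0, 0, 1]),
     (vector [0, 0, 0, 0, 1], vector [0, 0, 0, 0, 1], vector [1, 0, 0, 0, 0])]. tensor_vec3 u v w)"
    by (simp add: T_N15_def expand_simps tensor_vec3_def)
  then show ?thesis by (rule is_rank_decomp_list) simp
qed

text \<open>The last two products are a pair with \<open>y$4\<close> in the role of
  \<open>y_1\<close>. Its surplus \<open>x$1 * y$4\<close> at \<open>z$1\<close> is absorbed by the
  fourth product, whose \<open>y$4\<close> entry drops from 1/2 in \<open>T_N15\<close> to
  -1/2.\<close>

lemma N16_upper: "is_rank_decomp T_N16 9"
proof -
  have "T_N16 = (\<Sum>(u, v, w)\<leftarrow>
    [(vector [1, 1, 1, 0, 0], vector [0, 1, 1/2, -1/2, 0], vector [1, 1, 1, 0, 0]),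
     (vector [1, -1, 1, 0, 0], vector [0, -1/3, 1/2, -1/6, 0], vector [1, -1, 1, 0, 0]),
     (vector [1, 2, 4, 0, 0], vector [0, -1/6, 0, 1/6, 0], vector [1, 2, 4, 0, 0]),
     (vector [1, 0, 0, 0, 0], vector [1, -1/2, -1, -1/2, 0], vector [1, 0, 0, 0, 0]),
     (vector [0, 0, 1, 0, 0], vector [0, 2, -1, -2, 0], vector [0, 0, 1, 0, 0]),
     (vector [1, 0, 0, 0, 0], vector [0, 0, 0, 1, 0], vector [0, 0, 0, 1, 0]),
     (vector [0, 0, 0, 1, 0], vector [0, 0, 0, 1, 0], vector [1, 0, 0, 0, 0]),
     (vector [1, 0, 0, 0, 1], vector [0, 0, 0, 1/2, 1/2], vector [1, 0, 0, 0, 1]),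
     (vector [-1, 0, 0, 0, 1], vector [0, 0, 0, 1/2, -1/2], vector [-1, 0, 0, 0, 1])]. tensor_vec3 u v w)"
    by (simp add: T_N16_def expand_simps tensor_vec3_def)
  then show ?thesis by (rule is_rank_decomp_list) simp
qed

text \<open>
  \<open>T_N17\<close> is \<open>T_N15\<close> transposed, with the first four rows and columns reversed; so is this decomposition.
\<close>

lemma N17_upper: "is_rank_decomp T_N17 9"
proof -
  have "T_N17 = (\<Sum>(u, v, w)\<leftarrow>
    [(vector [1, 1, 1, 0, 0], vector [0, 1, 1, 1, 0], vector [-1/2, 1/2, 1, 0, 0]),
     (vector [1, -1, 1, 0, 0], vector [0, 1, -1, 1, 0], vector [-1/6, 1/2, -1/3, 0, 0]),
     (vector [1, 2, 4, 0, 0], vector [0, 4, 2, 1, 0], vector [1/6, 0, -1/6, 0, 0]),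
     (vector [1, 0, 0, 0, 0], vector [0, 0, 0, 1, 0], vector [1/2, -1, -1/2, 1, 0]),
     (vector [0, 0, 1, 0, 0], vector [0, 1, 0, 0, 0], vector [-2, -1, 2, 0, 0]),
     (vector [1, 0, 0, 0, 0], vector [1, 0, 0, 0, 0], vector [1, 0, 0, 0, 0]),
     (vector [0, 0, 0, 1, 0], vector [0, 0, 0, 1, 0], vector [1, 0, 0, 0, 0]),
     (vector [1, 0, 0, 0, 0], vector [0, 0, 0, 0, 1], vector [0, 0, 0, 0, 1]),
     (vector [0, 0, 0, 0, 1], vector [0, 0, 0, 1, 0], vector [0, 0, 0, 0, 1])]. tensor_vec3 u v w)"
    by (simp add: T_N17_def expand_simps tensor_vec3_def)
  then show ?thesis by (rule is_rank_decomp_list) simp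
qed

text \<open>Pairs for the indices 2 and 5, again with \<open>y$3\<close> as \<open>y_1\<close>. The
  fifth product cancels both surpluses and also supplies the \<open>z$3\<close> term; five single
  monomials remain.\<close>

lemma N6_8_upper: "is_rank_decomp T_N6_8 10"
proof -
  have "T_N6_8 = (\<Sum>(u, v, w)\<leftarrow>
    [(vector [1, 1, 0, 0, 0], vector [0, 1, 1, 0, 0], vector [1/2, 1/2, 0, 0, 0]),
     (vector [-1, 1, 0, 0, 0], vector [0, 1, -1, 0, 0], vector [1/2, -1/2, 0, 0, 0]),
     (vector [1, 0, 0, 0, 1], vector [0, 0, 1, 0, 1], vector [1/2, 0, 0, 0, 1/2]),
     (vector [-1, 0, 0, 0, 1], vector [0, 0, -1, 0, 1], vector [1/2, 0, 0, 0, -1/2]),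
     (vector [1, 0, 0, 0, 0], vector [0, 0, 1, 0, 0], vector [-2, 0, 1, 0, 0]),
     (vector [1, 0, 0, 0, 0], vector [1, 0, 0, 0, 0], vector [1, 0, 0, 0, 0]),
     (vector [0, 0, 1, 0, 0], vector [0, 0, 1, 0, 0], vector [1, 0, 0, 0, 0]),
     (vector [1, 0, 0, 0, 0], vector [0, 0, 0, 1, 0], vector [0, 0, 0, 1, 0]),
     (vector [0, 0, 0, 1, 0], vector [0, 0, 1, 0, 0], vector [0, 0, 0, 1, 0]),
     (vector [0, 0, 0, 0, 1], vector [0, 1, 0, 0, 0], vector [0, 0, 0, 1, 0])]. tensor_vec3 u v w)"
    by (simp add: T_N6_8_def expand_simps tensor_vec3_def)
  then show ?thesis by (rule is_rank_decomp_list) simp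
qed

text \<open>The mixed term is obtained as in Karatsuba multiplication:
  \<open>x$2 * y$5 + x$4 * y$2\<close> is \<open>(x$2 + x$4) * (y$2 + y$5)\<close> minus
  \<open>x$2 * y$2\<close> and \<open>x$4 * y$5\<close>, which the two pairs provide up to
  \<open>x$1 * y$3\<close>. The sixth product cancels these surpluses.\<close>

lemma N7_9_upper: "is_rank_decomp T_N7_9 10"
proof -
  have "T_N7_9 = (\<Sum>(u, v, w)\<leftarrow>
    [(vector [1, 1, 0, 0, 0], vector [0, 1, 1, 0, 0], vector [1/2, 1/2, 0, -1/2, 0]),
     (vector [-1, 1, 0, 0, 0], vector [0, 1, -1, 0, 0], vector [1/2, -1/2, 0, -1/2, 0]),
     (vector [1, 0, 0, 1, 0], vector [0, 0, 1, 0, 1], vector [0, 0, 0, -1/2, 1/2]),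
     (vector [-1, 0, 0, 1, 0], vector [0, 0, -1, 0, 1], vector [0, 0, 0, -1/2, -1/2]),
     (vector [0, 1, 0, 1, 0], vector [0, 1, 0, 0, 1], vector [0, 0, 0, 1, 0]),
     (vector [1, 0, 0, 0, 0], vector [0, 0, 1, 0, 0], vector [-1, 0, 1, 2, 0]),
     (vector [1, 0, 0, 0, 0], vector [1, 0, 0, 0, 0], vector [1, 0, 0, 0, 0]),
     (vector [0, 0, 1, 0, 0], vector [0, 0, 1, 0, 0], vector [1, 0, 0, 0, 0]),
     (vector [1, 0, 0, 0, 0], vector [0, 0, 0, 1, 0], vector [0, 0, 0, 1, 0]),
     (vector [0, 0, 0, 0, 1], vector [0, 0, 1, 0, 0], vector [0, 0, 0, 1, 0])]. tensor_vec3 u v w)"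
    by (simp add: T_N7_9_def expand_simps tensor_vec3_def)
  then show ?thesis by (rule is_rank_decomp_list) simp
qed

section \<open>Lower bound 9\<close>

text \<open>Each of \<open>b\<close>, \<open>c\<close>, \<open>d\<close>, \<open>e\<close> stands
  alone in some entry, which gives injectivity in \<open>x\<close> along \<open>a = 0\<close>. At
  \<open>a = 1\<close> the matrix is unitriangular after reordering the basis, hence invertible for
  all values of the other variables. The six lemmas that follow use the same argument.\<close>

lemma N1_4_lower:
  assumes "is_rank_decomp T_N1_4 r"
  shows "9 \<le> r"
proof -
  have "card {2, 3, 4, 5::5} + CARD(5) \<le> r"
  proof (rule rank_lower_bound_regular[OF assms, where ?x0.0 = "axis 1 1"])
    fix x :: "complex^5"
    assume "\<forall>i. i \<notin> {2, 3, 4, 5} \<longrightarrow> x $ i = 0" "\<forall>y z. tform T_N1_4 x y z = 0"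
    \<comment> \<open>Testing on unit vectors turns the hypothesis into the vanishing of every
      matrix entry.\<close>
    then have "x $ 1 = 0" "\<forall>j k. tform T_N1_4 x (axis j 1) (axis k 1) = 0" by auto
    then show "x = 0" by (simp add: vec_eq_iff forall_5 tform_N1_4 axis_def)
  next
    fix x y :: "complex^5"
    assume "\<forall>i. i \<notin> {2, 3, 4, 5} \<longrightarrow> x $ i = axis 1 1 $ i" "\<forall>z. tform T_N1_4 x y z = 0"
    then have "x $ 1 = 1" "\<forall>k. tform T_N1_4 x y (axis k 1) = 0" by (auto simp: axis_def)
    then show "y = 0" by (auto simp: vec_eq_iff forall_5 tform_N1_4 axis_def)
  qed
  then show ?thesis by simp
qed

lemma N10_12_lower:
  assumes "is_rank_decomp T_N10_12 r"
  shows "9 \<le> r"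
proof -
  have "card {2, 3, 4, 5::5} + CARD(5) \<le> r"
  proof (rule rank_lower_bound_regular[OF assms, where ?x0.0 = "axis 1 1"])
    fix x :: "complex^5"
    assume "\<forall>i. i \<notin> {2, 3, 4, 5} \<longrightarrow> x $ i = 0" "\<forall>y z. tform T_N10_12 x y z = 0"
    then have "x $ 1 = 0" "\<forall>j k. tform T_N10_12 x (axis j 1) (axis k 1) = 0" by auto
    then show "x = 0" by (simp add: vec_eq_iff forall_5 tform_N10_12 axis_def)
  next
    fix x y :: "complex^5"
    assume "\<forall>i. i \<notin> {2, 3, 4, 5} \<longrightarrow> x $ i = axis 1 1 $ i" "\<forall>z. tform T_N10_12 x y z = 0"
    then have "x $ 1 = 1" "\<forall>k. tform T_N10_12 x y (axis k 1) = 0" by (auto simp: axis_def)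
    then show "y = 0" by (auto simp: vec_eq_iff forall_5 tform_N10_12 axis_def)
  qed
  then show ?thesis by simp
qed

lemma N11_13_lower:
  assumes "is_rank_decomp T_N11_13 r"
  shows "9 \<le> r"
proof -
  have "card {2, 3, 4, 5::5} + CARD(5) \<le> r"
  proof (rule rank_lower_bound_regular[OF assms, where ?x0.0 = "axis 1 1"])
    fix x :: "complex^5"
    assume "\<forall>i. i \<notin> {2, 3, 4, 5} \<longrightarrow> x $ i = 0" "\<forall>y z. tform T_N11_13 x y z = 0"
    then have "x $ 1 = 0" "\<forall>j k. tform T_N11_13 x (axis j 1) (axis k 1) = 0" by auto
    then show "x = 0" by (simp add: vec_eq_iff forall_5 tform_N11_13 axis_def)
  next
    fix x y :: "complex^5"
    assume "\<forall>i. i \<notin> {2, 3, 4, 5} \<longrightarrow> x $ i = axis 1 1 $ i" "\<forall>z. tform T_N11_13 x y z = 0"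
    then have "x $ 1 = 1" "\<forall>k. tform T_N11_13 x y (axis k 1) = 0" by (auto simp: axis_def)
    then show "y = 0" by (auto simp: vec_eq_iff forall_5 tform_N11_13 axis_def)
  qed
  then show ?thesis by simp
qed

lemma N14_lower:
  assumes "is_rank_decomp T_N14 r"
  shows "9 \<le> r"
proof -
  have "card {2, 3, 4, 5::5} + CARD(5) \<le> r"
  proof (rule rank_lower_bound_regular[OF assms, where ?x0.0 = "axis 1 1"])
    fix x :: "complex^5"
    assume "\<forall>i. i \<notin> {2, 3, 4, 5} \<longrightarrow> x $ i = 0" "\<forall>y z. tform T_N14 x y z = 0"
    then have "x $ 1 = 0" "\<forall>j k. tform T_N14 x (axis j 1) (axis k 1) = 0" by auto
    then show "x = 0" by (simp add: vec_eq_iff forall_5 tform_N14 axis_def)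
  next
    fix x y :: "complex^5"
    assume "\<forall>i. i \<notin> {2, 3, 4, 5} \<longrightarrow> x $ i = axis 1 1 $ i" "\<forall>z. tform T_N14 x y z = 0"
    then have "x $ 1 = 1" "\<forall>k. tform T_N14 x y (axis k 1) = 0" by (auto simp: axis_def)
    then show "y = 0" by (auto simp: vec_eq_iff forall_5 tform_N14 axis_def)
  qed
  then show ?thesis by simp
qed

lemma N15_lower:
  assumes "is_rank_decomp T_N15 r"
  shows "9 \<le> r"
proof -
  have "card {2, 3, 4, 5::5} + CARD(5) \<le> r"
  proof (rule rank_lower_bound_regular[OF assms, where ?x0.0 = "axis 1 1"])
    fix x :: "complex^5"
    assume "\<forall>i. i \<notin> {2, 3, 4, 5} \<longrightarrow> x $ i = 0" "\<forall>y z. tform T_N15 x y z = 0"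
    then have "x $ 1 = 0" "\<forall>j k. tform T_N15 x (axis j 1) (axis k 1) = 0" by auto
    then show "x = 0" by (simp add: vec_eq_iff forall_5 tform_N15 axis_def)
  next
    fix x y :: "complex^5"
    assume "\<forall>i. i \<notin> {2, 3, 4, 5} \<longrightarrow> x $ i = axis 1 1 $ i" "\<forall>z. tform T_N15 x y z = 0"
    then have "x $ 1 = 1" "\<forall>k. tform T_N15 x y (axis k 1) = 0" by (auto simp: axis_def)
    then show "y = 0" by (auto simp: vec_eq_iff forall_5 tform_N15 axis_def)
  qed
  then show ?thesis by simp
qed

lemma N16_lower:
  assumes "is_rank_decomp T_N16 r"
  shows "9 \<le> r"
proof -
  have "card {2, 3, 4, 5::5} + CARD(5) \<le> r"
  proof (rule rank_lower_bound_regular[OF assms, where ?x0.0 = "axis 1 1"])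
    fix x :: "complex^5"
    assume "\<forall>i. i \<notin> {2, 3, 4, 5} \<longrightarrow> x $ i = 0" "\<forall>y z. tform T_N16 x y z = 0"
    then have "x $ 1 = 0" "\<forall>j k. tform T_N16 x (axis j 1) (axis k 1) = 0" by auto
    then show "x = 0" by (simp add: vec_eq_iff forall_5 tform_N16 axis_def)
  next
    fix x y :: "complex^5"
    assume "\<forall>i. i \<notin> {2, 3, 4, 5} \<longrightarrow> x $ i = axis 1 1 $ i" "\<forall>z. tform T_N16 x y z = 0"
    then have "x $ 1 = 1" "\<forall>k. tform T_N16 x y (axis k 1) = 0" by (auto simp: axis_def)
    then show "y = 0" by (auto simp: vec_eq_iff forall_5 tform_N16 axis_def)
  qed
  then show ?thesis by simp
qed

lemma N17_lower:
  assumes "is_rank_decomp T_N17 r"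
  shows "9 \<le> r"
proof -
  have "card {2, 3, 4, 5::5} + CARD(5) \<le> r"
  proof (rule rank_lower_bound_regular[OF assms, where ?x0.0 = "axis 1 1"])
    fix x :: "complex^5"
    assume "\<forall>i. i \<notin> {2, 3, 4, 5} \<longrightarrow> x $ i = 0" "\<forall>y z. tform T_N17 x y z = 0"
    then have "x $ 1 = 0" "\<forall>j k. tform T_N17 x (axis j 1) (axis k 1) = 0" by auto
    then show "x = 0" by (simp add: vec_eq_iff forall_5 tform_N17 axis_def)
  next
    fix x y :: "complex^5"
    assume "\<forall>i. i \<notin> {2, 3, 4, 5} \<longrightarrow> x $ i = axis 1 1 $ i" "\<forall>z. tform T_N17 x y z = 0"
    then have "x $ 1 = 1" "\<forall>k. tform T_N17 x y (axis k 1) = 0" by (auto simp: axis_def)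
    then show "y = 0" by (auto simp: vec_eq_iff forall_5 tform_N17 axis_def)
  qed
  then show ?thesis by simp
qed

section \<open>Lower bound 10\<close>

text \<open>The algebra has basis 1, s, t, p, q with s^2 = t^2 = p, ts = q, st = 0. The coordinates
  of 1, s, t, p, q are 1, 2, 5, 3, 4 in \<open>x\<close>, then 3, 2, 5, 1, 4 in \<open>y\<close> and
  \<open>z\<close>. The squared radical is spanned by p and q, and the output coordinate kept is
  that of p.\<close>

lemma N6_8_lower:
  assumes "is_rank_decomp T_N6_8 r"
  shows "10 \<le> r"
proof -
  have "card {3, 4::5} + card {1, 4::5} + card {2, 3, 4, 5::5} + 2 \<le> r"
  proof (rule rank_lower_bound_minor[OF assms, where ?p0.0 = 1 and ?k0.0 = 1
        and ?p1.0 = 2 and ?p2.0 = 5 and ?q1.0 = 2 and ?q2.0 = 5])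
    fix x :: "complex^5"
    assume "\<forall>i. i \<notin> {3, 4} \<longrightarrow> x $ i = 0" "\<forall>y z. tform T_N6_8 x y z = 0"
    then have "\<forall>i. i \<notin> {3, 4} \<longrightarrow> x $ i = 0" "\<forall>j k. tform T_N6_8 x (axis j 1) (axis k 1) = 0" by auto
    then show "x = 0" by (simp add: vec_eq_iff forall_5 tform_N6_8 axis_def)
  next
    fix x y :: "complex^5"
    assume "\<forall>i. i \<notin> {3, 4} \<longrightarrow> x $ i = axis 1 1 $ i" "\<forall>j. j \<notin> {1, 4} \<longrightarrow> y $ j = 0"
      "\<forall>z. tform T_N6_8 x y z = 0"
    then have "\<forall>i. i \<notin> {3, 4} \<longrightarrow> x $ i = axis 1 1 $ i" "\<forall>j. j \<notin> {1, 4} \<longrightarrow> y $ j = 0"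
      "\<forall>k. tform T_N6_8 x y (axis k 1) = 0" by auto
    then show "y = 0" by (auto simp: vec_eq_iff forall_5 tform_N6_8 axis_def)
  next
    fix X Y :: "5 \<Rightarrow> complex^5" and z :: "complex^5"
    assume X: "\<forall>p i. i \<notin> {3, 4} \<longrightarrow> X p $ i = axis p 1 $ i"
      and Y: "\<forall>q j. j \<notin> {1, 4} \<longrightarrow> Y q $ j = axis q 1 $ j"
      and z: "\<forall>k. k \<notin> {2, 3, 4, 5} \<longrightarrow> z $ k = 0"
      and zero: "\<forall>p q. tform T_N6_8 (X p) (Y q) z = 0"
    have X': "X 1 $ 1 = 1" "X 1 $ 2 = 0" "X 1 $ 5 = 0"
      "X 5 $ 1 = 0" "X 5 $ 2 = 0" "X 5 $ 5 = 1"
      by (simp_all add: X axis_def)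
    have Y': "Y 2 $ 2 = 1" "Y 2 $ 3 = 0" "Y 2 $ 5 = 0"
      "Y 3 $ 2 = 0" "Y 3 $ 3 = 1" "Y 3 $ 5 = 0"
      "Y 5 $ 2 = 0" "Y 5 $ 3 = 0" "Y 5 $ 5 = 1"
      by (simp_all add: Y axis_def)
    have "z $ 1 = 0" by (simp add: z)
    \<comment> \<open>The product ts gives \<open>z $ 4 = 0\<close>; multiplying the corrected unit
      by s, t and 1 then gives the other coordinates.\<close>
    moreover have "tform T_N6_8 (X 5) (Y 2) z = 0" "tform T_N6_8 (X 1) (Y 2) z = 0" "tform T_N6_8 (X 1) (Y 5) z = 0" "tform T_N6_8 (X 1) (Y 3) z = 0"
      by (simp_all only: zero)
    ultimately show "z = 0"
      by (auto simp: vec_eq_iff forall_5 tform_N6_8 X' Y')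
  next
    fix X Y :: "5 \<Rightarrow> complex^5" and z :: "complex^5"
    assume X: "\<forall>p i. i \<notin> {3, 4} \<longrightarrow> X p $ i = axis p 1 $ i"
      and Y: "\<forall>q j. j \<notin> {1, 4} \<longrightarrow> Y q $ j = axis q 1 $ j"
      and z: "\<forall>k. k \<notin> {2, 3, 4, 5} \<longrightarrow> z $ k = axis 1 1 $ k"
    have X': "X 2 $ 1 = 0" "X 2 $ 2 = 1" "X 2 $ 5 = 0"
      "X 5 $ 1 = 0" "X 5 $ 2 = 0" "X 5 $ 5 = 1"
      by (simp_all add: X axis_def)
    have Y': "Y 2 $ 2 = 1" "Y 2 $ 3 = 0" "Y 2 $ 5 = 0"
      "Y 5 $ 2 = 0" "Y 5 $ 3 = 0" "Y 5 $ 5 = 1"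
      by (simp_all add: Y axis_def)
    have "z $ 1 = 1" by (simp add: z axis_def)
    \<comment> \<open>On generators the unknown corrections drop out: they only multiply
      \<open>x$1\<close> or \<open>y$3\<close>. The matrix has rows \<open>(z$1, 0)\<close> and
      \<open>(z$4, z$1)\<close>, with determinant \<open>(z$1)^2 = 1\<close> for every
      \<open>z$4\<close>.\<close>
    then show "tform T_N6_8 (X 2) (Y 2) z * tform T_N6_8 (X 5) (Y 5) z
        \<noteq> tform T_N6_8 (X 2) (Y 5) z * tform T_N6_8 (X 5) (Y 2) z"
      by (simp add: tform_N6_8 X' Y')
  qed
  then show ?thesis by simp
qed

text \<open>Here the algebra is commutative with s^2 = p, st = ts = q, t^2 = 0. The coordinates of
  1, s, t, p, q are 1, 2, 4, 3, 5 in \<open>x\<close>, then 3, 2, 5, 1, 4 in \<open>y\<close> and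
  \<open>z\<close>. The output coordinate kept is that of q.\<close>

lemma N7_9_lower:
  assumes "is_rank_decomp T_N7_9 r"
  shows "10 \<le> r"
proof -
  have "card {3, 5::5} + card {1, 4::5} + card {1, 2, 3, 5::5} + 2 \<le> r"
  proof (rule rank_lower_bound_minor[OF assms, where ?p0.0 = 1 and ?k0.0 = 4
        and ?p1.0 = 2 and ?p2.0 = 4 and ?q1.0 = 2 and ?q2.0 = 5])
    fix x :: "complex^5"
    assume "\<forall>i. i \<notin> {3, 5} \<longrightarrow> x $ i = 0" "\<forall>y z. tform T_N7_9 x y z = 0"
    then have "\<forall>i. i \<notin> {3, 5} \<longrightarrow> x $ i = 0" "\<forall>j k. tform T_N7_9 x (axis j 1) (axis k 1) = 0" by auto
    then show "x = 0" by (simp add: vec_eq_iff forall_5 tform_N7_9 axis_def)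
  next
    fix x y :: "complex^5"
    assume "\<forall>i. i \<notin> {3, 5} \<longrightarrow> x $ i = axis 1 1 $ i" "\<forall>j. j \<notin> {1, 4} \<longrightarrow> y $ j = 0"
      "\<forall>z. tform T_N7_9 x y z = 0"
    then have "\<forall>i. i \<notin> {3, 5} \<longrightarrow> x $ i = axis 1 1 $ i" "\<forall>j. j \<notin> {1, 4} \<longrightarrow> y $ j = 0"
      "\<forall>k. tform T_N7_9 x y (axis k 1) = 0" by auto
    then show "y = 0" by (auto simp: vec_eq_iff forall_5 tform_N7_9 axis_def)
  next
    fix X Y :: "5 \<Rightarrow> complex^5" and z :: "complex^5"
    assume X: "\<forall>p i. i \<notin> {3, 5} \<longrightarrow> X p $ i = axis p 1 $ i"
      and Y: "\<forall>q j. j \<notin> {1, 4} \<longrightarrow> Y q $ j = axis q 1 $ j"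
      and z: "\<forall>k. k \<notin> {1, 2, 3, 5} \<longrightarrow> z $ k = 0"
      and zero: "\<forall>p q. tform T_N7_9 (X p) (Y q) z = 0"
    have X': "X 1 $ 1 = 1" "X 1 $ 2 = 0" "X 1 $ 4 = 0"
      "X 2 $ 1 = 0" "X 2 $ 2 = 1" "X 2 $ 4 = 0"
      by (simp_all add: X axis_def)
    have Y': "Y 2 $ 2 = 1" "Y 2 $ 3 = 0" "Y 2 $ 5 = 0"
      "Y 3 $ 2 = 0" "Y 3 $ 3 = 1" "Y 3 $ 5 = 0"
      "Y 5 $ 2 = 0" "Y 5 $ 3 = 0" "Y 5 $ 5 = 1"
      by (simp_all add: Y axis_def)
    have "z $ 4 = 0" by (simp add: z)
    \<comment> \<open>Since \<open>z $ 4 = 0\<close>, the product of s with itself isolates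
      \<open>z $ 1\<close>; the corrected unit again yields the rest.\<close>
    moreover have "tform T_N7_9 (X 2) (Y 2) z = 0" "tform T_N7_9 (X 1) (Y 2) z = 0" "tform T_N7_9 (X 1) (Y 5) z = 0" "tform T_N7_9 (X 1) (Y 3) z = 0"
      by (simp_all only: zero)
    ultimately show "z = 0"
      by (auto simp: vec_eq_iff forall_5 tform_N7_9 X' Y')
  next
    fix X Y :: "5 \<Rightarrow> complex^5" and z :: "complex^5"
    assume X: "\<forall>p i. i \<notin> {3, 5} \<longrightarrow> X p $ i = axis p 1 $ i"
      and Y: "\<forall>q j. j \<notin> {1, 4} \<longrightarrow> Y q $ j = axis q 1 $ j"
      and z: "\<forall>k. k \<notin> {1, 2, 3, 5} \<longrightarrow> z $ k = axis 4 1 $ k"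
    have X': "X 2 $ 1 = 0" "X 2 $ 2 = 1" "X 2 $ 4 = 0"
      "X 4 $ 1 = 0" "X 4 $ 2 = 0" "X 4 $ 4 = 1"
      by (simp_all add: X axis_def)
    have Y': "Y 2 $ 2 = 1" "Y 2 $ 3 = 0" "Y 2 $ 5 = 0"
      "Y 5 $ 2 = 0" "Y 5 $ 3 = 0" "Y 5 $ 5 = 1"
      by (simp_all add: Y axis_def)
    have "z $ 4 = 1" by (simp add: z axis_def)
    \<comment> \<open>The matrix has rows \<open>(z$1, z$4)\<close> and \<open>(z$4, 0)\<close>. Its
      determinant \<open>-(z$4)^2 = -1\<close> does not involve the unknown \<open>z$1\<close>,
      which is why \<open>z$4\<close> is the coordinate to keep.\<close>
    then show "tform T_N7_9 (X 2) (Y 2) z * tform T_N7_9 (X 4) (Y 5) z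
        \<noteq> tform T_N7_9 (X 2) (Y 5) z * tform T_N7_9 (X 4) (Y 2) z"
      by (simp add: tform_N7_9 X' Y')
  qed
  then show ?thesis by simp
qed

theorem proposition6p6:
  shows "tensor_rank T_N1_4 = 9 \<and> tensor_rank T_N10_12 = 9 \<and> tensor_rank T_N11_13 = 9 \<and>
         tensor_rank T_N14 = 9 \<and> tensor_rank T_N15 = 9 \<and> tensor_rank T_N16 = 9 \<and>
         tensor_rank T_N17 = 9 \<and>
         tensor_rank T_N6_8 = 10 \<and> tensor_rank T_N7_9 = 10"
  by (intro conjI tensor_rank_eqI)
    (fact N1_4_upper N1_4_lower N10_12_upper N10_12_lower
      N11_13_upper N11_13_lower N14_upper N14_lower N15_upper N15_lower
      N16_upper N16_lower N17_upper N17_lower N6_8_upper N6_8_lower N7_9_upper N7_9_lower)+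

end
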